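(* Let $p$ be an odd prime and let $k$ be a positive integer with $\gcd(k,p-1)=1$. Let $\tau_{k,p}$ be the permutation of $\{1,2,\dots,p-1\}$ defined by $\tau_{k,p}(i)=\{i^k\}_p$, where $\{a\}_p$ denotes the least nonnegative residue of $a$ modulo $p$. Then $$\operatorname{sgn}(\tau_{k,p})=\begin{cases}1&\text{if } p\equiv 3\pmod 4,\\ (-1)^{\frac{k-1}{2}}&\text{if } p\equiv 1\pmod 4.\end{cases}$$
   Context: $\operatorname{sgn}(\pi)$ is $1$ if the permutation $\pi$ is even and $-1$ if it is odd. The hypothesis $\gcd(k,p-1)=1$ guarantees that $i\mapsto\{i^k\}_p$ is a bijection of $\{1,\dots,p-1\}$. *)

theory Defs
  imports "HOL-Combinatorics.Permutations" "HOL-Number_Theory.Number_Theory"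
begin

text \<open>
  Only the values of \<open>power_perm k p\<close> on \<open>{1..p - 1}\<close> matter; there it is a permutation,
  as \<open>bij_betw_power_perm\<close> below shows.
\<close>

definition power_perm :: "nat \<Rightarrow> nat \<Rightarrow> nat \<Rightarrow> nat" where
  "power_perm k p i = i ^ k mod p"

lemma bij_betw_power_perm:
  fixes p k :: nat
  assumes p: "prime p" "odd p" and k: "k > 0" and cop: "gcd k (p - 1) = 1"
  shows "bij_betw (power_perm k p) {1..p - 1} {1..p - 1}"
proof -
  have p2: "p > 2"
    using p by (metis even_numeral prime_ge_2_nat order_le_less)
  have nd: "\<not> p dvd i" if "i \<in> {1..p - 1}" for i
    using that p2 by (auto dest: dvd_imp_le)
  obtain a where a: "[k * a = 1] (mod (p - 1))"
    using cong_solve_coprime_nat[of k "p - 1"] cop by (metis One_nat_def coprime_iff_gcd_eq_1)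
  have "a \<noteq> 0"
  proof
    assume "a = 0"
    with a have "p - 1 dvd 1" by (simp add: cong_0_iff cong_sym_eq[of 0])
    with p2 show False by simp
  qed
  then have "k * a \<ge> 1"
    using k by (simp add: Suc_le_eq)
  then obtain b where b: "k * a = 1 + b * (p - 1)"
    using cong_le_nat[of 1 "k * a" "p - 1"] a by (metis cong_sym mult.commute add.commute)
  have inv: "[(i ^ k) ^ a = i] (mod p)" if "i \<in> {1..p - 1}" for i
  proof -
    have "[(i ^ (p - 1)) ^ b = 1 ^ b] (mod p)"
      using fermat_theorem[OF p(1) nd[OF that]] by (rule cong_pow)
    then have "[i * (i ^ (p - 1)) ^ b = i * 1] (mod p)"
      by (intro cong_mult cong_refl) simp
    moreover have "(i ^ k) ^ a = i * (i ^ (p - 1)) ^ b"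
      using b by (simp add: power_mult [symmetric] mult.commute)
    ultimately show ?thesis by simp
  qed
  have inj: "inj_on (power_perm k p) {1..p - 1}"
  proof (rule inj_onI)
    fix i j assume ij: "i \<in> {1..p - 1}" "j \<in> {1..p - 1}" "power_perm k p i = power_perm k p j"
    then have "[i ^ k = j ^ k] (mod p)"
      by (simp add: power_perm_def cong_def)
    then have "[(i ^ k) ^ a = (j ^ k) ^ a] (mod p)"
      by (rule cong_pow)
    then have "[i = j] (mod p)"
      using inv ij by (meson cong_sym cong_trans)
    then show "i = j"
      using ij p2 by (auto simp: cong_def)
  qed
  have "power_perm k p ` {1..p - 1} \<subseteq> {1..p - 1}"
  proof (rule image_subsetI)
    fix i assume "i \<in> {1..p - 1}"
    then have "\<not> p dvd i ^ k"
      using nd p(1) prime_dvd_power by blast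
    then have "i ^ k mod p \<noteq> 0" by (simp add: dvd_eq_mod_eq_0)
    moreover have "i ^ k mod p < p" using p2 by simp
    ultimately show "power_perm k p i \<in> {1..p - 1}"
      unfolding power_perm_def atLeastAtMost_iff by linarith
  qed
  then show ?thesis
    using inj by (simp add: bij_betw_def endo_inj_surj)
qed

end

theory Submission
  imports Defs
begin

text \<open>
  Let \<open>h = (p - 1) / 2\<close>. As \<open>k\<close> is odd, the permutation commutes with the fixed-point-free
  involution \<open>x \<mapsto> p - x\<close>. Such a permutation is a product of some \<open>F\<close> transpositions
  \<open>(x, p - x)\<close> and of two copies of one permutation of \<open>{1..h}\<close>, so its sign is \<open>(-1) ^ F\<close>.
  As in Gauss's lemma, multiplying the values at \<open>1, \<dots>, h\<close> gives
  \<open>(h!) ^ k \<equiv> (-1) ^ F * h! (mod p)\<close>, and \<open>(h!)\<^sup>2 \<equiv> (-1) ^ (h + 1)\<close> by Wilson's theorem.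
\<close>

section \<open>Products of transpositions of reflected pairs\<close>

lemma bij_betw_reflect: "bij_betw (\<lambda>x. 2 * h + 1 - x) {1..2 * h} {1..2 * (h::nat)}"
  by (rule bij_betw_byWitness[where f' = "\<lambda>x. 2 * h + 1 - x"]) auto

text \<open>Induction on \<open>F\<close>: since \<open>F\<close> lies in the lower half, a new
  element \<open>r\<close> adds the transposition of \<open>r\<close> with its mirror image,
  disjoint from the earlier ones, and so flips the sign once.\<close>

lemma sign_on_partial_reflect:
  fixes h :: nat
  assumes "F \<subseteq> {1..h}"
  defines "T \<equiv> \<lambda>F x. if x \<in> F \<or> 2 * h + 1 - x \<in> F then 2 * h + 1 - x else x"
  shows "bij_betw (T F) {1..2 * h} {1..2 * h} \<and> sign_on {1..2 * h} (T F) = (- 1) ^ card F"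
proof -
  have "finite F" using assms(1) finite_subset by blast
  then show ?thesis using assms(1)
  proof (induction F rule: finite_induct)
    case empty
    then show ?case by (auto simp: T_def bij_betw_def)
  next
    case (insert r F)
    let ?A = "{1..2 * h}" and ?t = "transpose r (2 * h + 1 - r)"
    have IH: "bij_betw (T F) ?A ?A" "sign_on ?A (T F) = (- 1) ^ card F"
      using insert by auto
    have r: "r \<in> ?A" "2 * h + 1 - r \<in> ?A" "r \<noteq> 2 * h + 1 - r" "2 * h + 1 - r \<notin> F"
      using insert.prems by (auto dest!: subsetD)
    have bt: "bij_betw ?t ?A ?A"
      using r permutes_imp_bij permutes_swap_id by metis
    have eq: "T (insert r F) x = (T F \<circ> ?t) x" if "x \<in> ?A" for x
    proof -
      consider "x = r" | "x = 2 * h + 1 - r" | "x \<noteq> r" "x \<noteq> 2 * h + 1 - r" by blast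
      then show ?thesis
      proof cases
        case 3
        then have "2 * h + 1 - x \<noteq> r" using that r by auto
        with 3 show ?thesis by (simp add: T_def)
      qed (use r insert.hyps insert.prems in \<open>auto simp: T_def\<close>)
    qed
    have "bij_betw (T F \<circ> ?t) ?A ?A"
      using bt IH(1) by (rule bij_betw_trans)
    then have "bij_betw (T (insert r F)) ?A ?A"
      using bij_betw_cong[of ?A "T (insert r F)"] eq by blast
    moreover have "sign_on ?A (T (insert r F)) = sign_on ?A (T F \<circ> ?t)"
      using eq by (rule sign_on_cong[OF refl])
    moreover have "\<dots> = - ((- 1) ^ card F)"
      using sign_on_compose[OF IH(1) bt] IH(2) r by (simp add: sign_on_transpose)
    ultimately show ?case using insert.hyps by simp
  qed
qed

section \<open>Permutations commuting with the reflection\<close>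

locale reflection_equivariant =
  fixes h :: nat and f :: "nat \<Rightarrow> nat"
  assumes bij: "bij_betw f {1..2 * h} {1..2 * h}"
    and equivariant: "x \<in> {1..2 * h} \<Longrightarrow> f (2 * h + 1 - x) = 2 * h + 1 - f x"
begin

text \<open>The action of \<open>f\<close> on the pairs \<open>{x, 2 * h + 1 - x}\<close>, each
  represented by its smaller element; in Gauss's lemma this is the absolute value of the least
  absolute residue.\<close>

definition folded :: "nat \<Rightarrow> nat" where
  "folded x = (if f x \<le> h then f x else 2 * h + 1 - f x)"

lemma range: "x \<in> {1..2 * h} \<Longrightarrow> f x \<in> {1..2 * h}"
  using bij bij_betwE by blast

text \<open>If two folded values agree, then \<open>f x\<close> is \<open>f y\<close> or its mirror
  image, which by equivariance is \<open>f (2 * h + 1 - y)\<close>. Injectivity of \<open>f\<close>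
  gives \<open>x = y\<close>, because the mirror image of \<open>y\<close> lies in the upper
  half.\<close>

lemma bij_betw_folded: "bij_betw folded {1..h} {1..h}"
proof -
  have "inj_on folded {1..h}"
  proof (rule inj_onI)
    fix x y assume xy: "x \<in> {1..h}" "y \<in> {1..h}" "folded x = folded y"
    then have mem: "x \<in> {1..2 * h}" "y \<in> {1..2 * h}" "2 * h + 1 - y \<in> {1..2 * h}" by auto
    have "f x = f y \<or> f x = f (2 * h + 1 - y)"
      using xy(3) range[OF mem(1)] range[OF mem(2)] equivariant[OF mem(2)]
      by (auto simp: folded_def split: if_splits)
    then have "x = y \<or> x = 2 * h + 1 - y"
      using bij mem by (auto simp: bij_betw_def dest: inj_onD)
    then show "x = y" using xy by auto
  qed
  moreover have "folded ` {1..h} \<subseteq> {1..h}"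
  proof (rule image_subsetI)
    fix x assume "x \<in> {1..h}"
    then show "folded x \<in> {1..h}" using range[of x] by (auto simp: folded_def)
  qed
  ultimately show ?thesis by (simp add: bij_betw_def endo_inj_surj)
qed

lemma sign_on_eq: "sign_on {1..2 * h} f = (- 1) ^ card {x \<in> {1..h}. h < f x}"
proof -
  let ?A = "{1..2 * h}"
  define F where "F = {x \<in> {1..h}. h < f x}"
  define s where "s = (\<lambda>x. 2 * h + 1 - x)"
  define T where "T = (\<lambda>x. if x \<in> F \<or> 2 * h + 1 - x \<in> F then 2 * h + 1 - x else x)"
  define D where "D = (\<lambda>x. if x \<in> {1..h} then folded x else x)"
  have T: "bij_betw T ?A ?A" "sign_on ?A T = (- 1) ^ card F"
    using sign_on_partial_reflect[of F h] unfolding T_def F_def by blast+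
  have s: "bij_betw s ?A ?A"
    unfolding s_def by (rule bij_betw_reflect)
  have "bij_betw D ({1..h} \<union> {h + 1..2 * h}) ({1..h} \<union> {h + 1..2 * h})"
  proof (rule bij_betw_combine)
    show "bij_betw D {1..h} {1..h}"
      using bij_betw_folded bij_betw_cong[of "{1..h}" D folded] by (simp add: D_def)
    have "bij_betw id {h + 1..2 * h} {h + 1..2 * h}" by simp
    then show "bij_betw D {h + 1..2 * h} {h + 1..2 * h}"
      using bij_betw_cong[of "{h + 1..2 * h}" D id] by (simp add: D_def)
  qed auto
  moreover have "{1..h} \<union> {h + 1..2 * h} = ?A" by auto
  ultimately have D: "bij_betw D ?A ?A" by simp
  \<comment> \<open>\<open>s \<circ> D \<circ> s\<close> is the copy of \<open>D\<close> on the
    upper half. Hence the square of \<open>D \<circ> s\<close> performs \<open>folded\<close> on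
    both halves at once, and as a square it is even.\<close>
  have Ds: "bij_betw (D \<circ> s) ?A ?A"
    using s D by (rule bij_betw_trans)
  have DsDs: "bij_betw ((D \<circ> s) \<circ> (D \<circ> s)) ?A ?A"
    using Ds Ds by (rule bij_betw_trans)
  have folded_range: "folded x \<in> {1..h}" if "x \<in> {1..h}" for x
    using bij_betw_folded that bij_betwE by blast
  have lower: "((D \<circ> s) \<circ> (D \<circ> s)) x = folded x" if "x \<in> {1..h}" for x
    using that by (auto simp: D_def s_def)
  have upper: "((D \<circ> s) \<circ> (D \<circ> s)) x = s (folded (s x))" if "x \<in> {h + 1..2 * h}" for x
  proof -
    have "s x \<in> {1..h}" using that by (auto simp: s_def)
    moreover from folded_range[OF this] have "s (s (folded (s x))) = folded (s x)"
      "s (folded (s x)) \<notin> {1..h}" by (auto simp: s_def)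
    ultimately show ?thesis unfolding D_def comp_def by presburger
  qed
  \<comment> \<open>\<open>T\<close> first moves to the other half those points that
    \<open>f\<close> sends across; the two parallel copies of \<open>folded\<close> then finish
    within each half.\<close>
  have "f x = (((D \<circ> s) \<circ> (D \<circ> s)) \<circ> T) x" if x: "x \<in> ?A" for x
  proof (cases "x \<le> h")
    case True
    then have xh: "x \<in> {1..h}" using x by simp
    then have sx: "s x \<in> {h + 1..2 * h}" "s (s x) = x" "s x \<notin> F" by (auto simp: s_def F_def)
    have Tx: "T x = (if x \<in> F then s x else x)"
      using sx by (auto simp: T_def s_def)
    show ?thesis
    proof (cases "x \<in> F")
      case True
      then have "s (folded x) = f x"
        using range[OF x] by (auto simp: F_def folded_def s_def)
      then show ?thesis using True Tx upper[OF sx(1)] sx(2) by simp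
    next
      case False
      then have "folded x = f x" using xh by (auto simp: F_def folded_def)
      then show ?thesis using False Tx lower[OF xh] by simp
    qed
  next
    case False
    then have xh: "x \<in> {h + 1..2 * h}" using x by simp
    then have sx: "s x \<in> {1..h}" "s (s x) = x" "x \<notin> F" by (auto simp: s_def F_def)
    have fs: "f (s x) = s (f x)" unfolding s_def by (rule equivariant[OF x])
    have Tx: "T x = (if s x \<in> F then s x else x)"
      using sx by (auto simp: T_def s_def)
    show ?thesis
    proof (cases "s x \<in> F")
      case True
      then have "folded (s x) = f x"
        using range[OF x] fs by (auto simp: F_def folded_def s_def)
      then show ?thesis using True Tx lower[OF sx(1)] by simp
    next
      case False
      then have "s (folded (s x)) = f x"
        using range[OF x] fs sx by (auto simp: F_def folded_def s_def)
      then show ?thesis using False Tx upper[OF xh] by simp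
    qed
  qed
  then have "sign_on ?A f = sign_on ?A (((D \<circ> s) \<circ> (D \<circ> s)) \<circ> T)"
    by (rule sign_on_cong[OF refl])
  also have "\<dots> = sign_on ?A ((D \<circ> s) \<circ> (D \<circ> s)) * sign_on ?A T"
    by (rule sign_on_compose[OF DsDs T(1)]) simp
  also have "sign_on ?A ((D \<circ> s) \<circ> (D \<circ> s)) = sign_on ?A (D \<circ> s) * sign_on ?A (D \<circ> s)"
    by (rule sign_on_compose[OF Ds Ds]) simp
  also have "\<dots> = 1" by (simp add: sign_on_def)
  finally show ?thesis using T(2) by (simp add: F_def)
qed

text \<open>Each \<open>f x\<close> is congruent to \<open>folded x\<close> up to a sign, negative
  exactly at the points counted in \<open>sign_on_eq\<close>, and the folded values run through
  \<open>{1..h}\<close>.\<close>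

lemma prod_cong:
  "[(\<Prod>x\<in>{1..h}. int (f x)) = sign_on {1..2 * h} f * fact h] (mod int (2 * h + 1))"
proof -
  let ?e = "\<lambda>x. if h < f x then - 1 else 1 :: int"
  have "[int (f x) = ?e x * int (folded x)] (mod int (2 * h + 1))" if "x \<in> {1..h}" for x
    using range[of x] that by (auto simp: folded_def cong_iff_dvd_diff of_nat_diff)
  then have "[(\<Prod>x\<in>{1..h}. int (f x)) = (\<Prod>x\<in>{1..h}. ?e x * int (folded x))] (mod int (2 * h + 1))"
    by (rule cong_prod)
  also have "(\<Prod>x\<in>{1..h}. ?e x * int (folded x)) = (\<Prod>x\<in>{1..h}. ?e x) * (\<Prod>x\<in>{1..h}. int (folded x))"
    by (rule prod.distrib)
  also have "(\<Prod>x\<in>{1..h}. ?e x) = sign_on {1..2 * h} f"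
    by (subst sign_on_eq) (simp add: prod.If_cases Int_def)
  also have "(\<Prod>x\<in>{1..h}. int (folded x)) = (\<Prod>x\<in>{1..h}. int x)"
    by (rule prod.reindex_bij_betw[OF bij_betw_folded])
  also have "\<dots> = fact h" by (simp add: fact_prod)
  finally show ?thesis .
qed

end

section \<open>Wilson's theorem and the power map modulo p\<close>

text \<open>Modulo \<open>2 * h + 1\<close>, the upper half of the product \<open>(2 * h)!\<close>
  consists of the negatives of \<open>1, ..., h\<close>, so Wilson's theorem evaluates
  \<open>(- 1) ^ h * (fact h)\<^sup>2\<close>.\<close>

lemma fact_half_square_cong:
  fixes h :: nat
  assumes "prime (2 * h + 1)"
  shows "[(fact h)\<^sup>2 = (- 1) ^ (h + 1)] (mod int (2 * h + 1))"
proof -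
  let ?p = "int (2 * h + 1)"
  have "{1..2 * h} = {1..h} \<union> {h + 1..2 * h}" by auto
  then have "(fact (2 * h) :: int) = (\<Prod>x\<in>{1..h}. int x) * (\<Prod>x\<in>{h + 1..2 * h}. int x)"
    by (simp add: fact_prod prod.union_disjoint)
  also have "(\<Prod>x\<in>{h + 1..2 * h}. int x) = (\<Prod>x\<in>{1..h}. int (2 * h + 1 - x))"
    by (rule prod.reindex_bij_witness[of _ "\<lambda>x. 2 * h + 1 - x" "\<lambda>x. 2 * h + 1 - x"]) auto
  finally have eq: "(fact (2 * h) :: int) = fact h * (\<Prod>x\<in>{1..h}. int (2 * h + 1 - x))"
    by (simp add: fact_prod)
  have "[(\<Prod>x\<in>{1..h}. int (2 * h + 1 - x)) = (\<Prod>x\<in>{1..h}. - 1 * int x)] (mod ?p)"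
    by (rule cong_prod) (auto simp: cong_iff_dvd_diff of_nat_diff)
  also have "(\<Prod>x\<in>{1..h}. - 1 * int x) = (- 1) ^ h * fact h"
    by (subst prod.distrib) (simp add: fact_prod)
  finally have "[fact (2 * h) = fact h * ((- 1) ^ h * fact h)] (mod ?p)"
    unfolding eq by (rule cong_scalar_left)
  moreover have "[fact (2 * h) = - 1] (mod ?p)"
    using wilson_theorem[OF assms] by simp
  ultimately have "[fact h * ((- 1) ^ h * fact h) = - 1] (mod ?p)"
    by (meson cong_sym cong_trans)
  \<comment> \<open>The factor \<open>(- 1) ^ h\<close> is its own inverse, so multiplying by it
    isolates the square.\<close>
  then have "[(- 1) ^ h * (fact h * ((- 1) ^ h * fact h)) = (- 1) ^ h * - 1] (mod ?p)"
    by (rule cong_scalar_left)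
  moreover have "(- 1) ^ h * (fact h * ((- 1) ^ h * fact h)) = (fact h :: int)\<^sup>2"
    by (simp add: power2_eq_square flip: power_mult_distrib)
  ultimately show ?thesis by simp
qed

text \<open>An odd power turns negation into negation, so the two residues add up to a multiple of
  \<open>p\<close>. Their sum is nonzero and below \<open>2 * p\<close>, hence equal to
  \<open>p\<close>.\<close>

lemma power_perm_reflect:
  assumes "odd p" "odd k" "x \<le> p" "power_perm k p x \<noteq> 0"
  shows "power_perm k p (p - x) = p - power_perm k p x"
proof -
  have "[int (p - x) = - int x] (mod int p)"
    using assms by (simp add: cong_iff_dvd_diff of_nat_diff)
  then have "[int (p - x) ^ k = (- int x) ^ k] (mod int p)"
    by (rule cong_pow)
  then have "[int ((p - x) ^ k) = - int (x ^ k)] (mod int p)"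
    using assms by simp
  then have "int p dvd int ((p - x) ^ k + x ^ k)"
    by (simp add: cong_iff_dvd_diff)
  then have "p dvd (p - x) ^ k + x ^ k"
    by (simp only: int_dvd_int_iff)
  then have "(power_perm k p (p - x) + power_perm k p x) mod p = 0"
    by (simp add: power_perm_def mod_add_eq)
  then have "p dvd power_perm k p (p - x) + power_perm k p x" by auto
  then obtain c where c: "power_perm k p (p - x) + power_perm k p x = p * c" by auto
  have p: "p > 0" using assms by (auto intro: gr0I)
  then have "power_perm k p (p - x) < p" "power_perm k p x < p"
    by (simp_all add: power_perm_def)
  then have "p * c < p * 2" using c by linarith
  then have "c < 2" by simp
  moreover have "c \<noteq> 0" using c assms(4) by (metis add_is_0 mult_0_right)
  ultimately have "c = 1" by simp
  with c show ?thesis by simp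
qed

lemma sign_on_power_perm:
  fixes h k :: nat
  assumes p: "prime (2 * h + 1)" and h: "h > 0" and k: "k > 0" and cop: "coprime k (2 * h)"
  shows "sign_on {1..2 * h} (power_perm k (2 * h + 1)) = (- 1) ^ ((h + 1) * ((k - 1) div 2))"
proof -
  define p where "p = 2 * h + 1"
  have pp: "prime p" "odd p" using p by (auto simp: p_def)
  have oddk: "odd k" using cop by auto
  define m where "m = (k - 1) div 2"
  have km: "k = 2 * m + 1" using oddk by (auto simp: m_def elim: oddE)
  have bij: "bij_betw (power_perm k p) {1..2 * h} {1..2 * h}"
    using bij_betw_power_perm[of p k] pp k cop by (simp add: p_def)
  interpret reflection_equivariant h "power_perm k p"
  proof
    show "bij_betw (power_perm k p) {1..2 * h} {1..2 * h}" by (rule bij)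
    fix x assume x: "x \<in> {1..2 * h}"
    then have "power_perm k p x \<in> {1..2 * h}" using bij bij_betwE by blast
    then show "power_perm k p (2 * h + 1 - x) = 2 * h + 1 - power_perm k p x"
      using power_perm_reflect[of p k x] x pp oddk by (simp add: p_def)
  qed
  let ?s = "sign_on {1..2 * h} (power_perm k p)"
  have "[(\<Prod>x\<in>{1..h}. int (power_perm k p x)) = (\<Prod>x\<in>{1..h}. int x ^ k)] (mod int p)"
    by (rule cong_prod) (simp add: power_perm_def zmod_int cong_def)
  also have "(\<Prod>x\<in>{1..h}. int x ^ k) = fact h ^ k"
    by (simp add: fact_prod prod_power_distrib)
  also have "\<dots> = ((fact h)\<^sup>2) ^ m * fact h"
    by (simp add: km power_mult)
  \<comment> \<open>Two evaluations of the same product: through \<open>prod_cong\<close>, and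
    directly as a \<open>k\<close>-th power.\<close>
  finally have "[?s * fact h = ((fact h)\<^sup>2) ^ m * fact h] (mod int p)"
    using prod_cong cong_sym cong_trans unfolding p_def by blast
  moreover have "coprime (fact h) (int p)"
  proof -
    \<comment> \<open>The prime \<open>p\<close> exceeds \<open>h\<close>, so \<open>fact h\<close>
      can be cancelled.\<close>
    have "\<not> p dvd fact h" using pp by (simp add: prime_dvd_fact_iff p_def)
    then have "coprime (fact h) p" using pp by (simp add: prime_imp_coprime coprime_commute)
    then have "coprime (int (fact h)) (int p)" by (simp only: coprime_int_iff)
    then show ?thesis by simp
  qed
  ultimately have "[?s = ((fact h)\<^sup>2) ^ m] (mod int p)"
    by (simp add: cong_mult_rcancel)
  moreover have "[((fact h)\<^sup>2) ^ m = ((- 1) ^ (h + 1)) ^ m] (mod int p)"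
    using fact_half_square_cong[OF p] unfolding p_def by (rule cong_pow)
  ultimately have cong: "[?s = (- 1) ^ ((h + 1) * m)] (mod int p)"
    by (metis cong_trans power_mult)
  have "?s = 1 \<or> ?s = - 1"
    by (simp add: sign_on_def sign_def)
  moreover have "(- 1 :: int) ^ ((h + 1) * m) = 1 \<or> (- 1 :: int) ^ ((h + 1) * m) = - 1"
    by (auto simp: minus_one_power_iff)
  \<comment> \<open>Distinct signs differ by 2 or -2, which \<open>p > 2\<close> does not divide, so
    congruent signs are equal.\<close>
  moreover have "\<not> int p dvd 2" "\<not> int p dvd - 2"
    using h zdvd_imp_le[of "int p" 2] by (auto simp: p_def)
  ultimately show ?thesis
    using cong by (auto simp: cong_iff_dvd_diff m_def p_def)
qed

theorem theorem1p2:
  fixes p k :: nat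
  assumes "prime p" and "odd p" and "k > 0" and "gcd k (p - 1) = 1"
  shows "([p = 3] (mod 4) \<longrightarrow> sign_on {1..p - 1} (power_perm k p) = 1) \<and>
         ([p = 1] (mod 4) \<longrightarrow> sign_on {1..p - 1} (power_perm k p) = (- 1) ^ ((k - 1) div 2))"
proof -
  obtain h where h: "p = 2 * h + 1" using \<open>odd p\<close> by (auto elim: oddE)
  then have "h > 0" using \<open>prime p\<close> by (auto intro: gr0I)
  moreover have "coprime k (2 * h)" using assms(4) unfolding h coprime_iff_gcd_eq_1 by simp
  ultimately have sign: "sign_on {1..p - 1} (power_perm k p) = (- 1) ^ ((h + 1) * ((k - 1) div 2))"
    using sign_on_power_perm[of h k] assms by (simp add: h)
  \<comment> \<open>For odd \<open>h\<close> the factor \<open>h + 1\<close> makes the exponent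
    even; for even \<open>h\<close> it is odd and leaves only the parity of
    \<open>(k - 1) div 2\<close>.\<close>
  have "odd h" if "[p = 3] (mod 4)"
    using that unfolding cong_def h by presburger
  moreover have "even h" if "[p = 1] (mod 4)"
    using that unfolding cong_def h by presburger
  ultimately show ?thesis
    unfolding sign power_mult by auto
qed

end
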